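(* Let $\mathcal{C}$ be a family of homothets of a strictly convex curve $C\subset\mathbb{R}^2$. (i) If every 3 sets in $\mathcal{C}$ have a nonempty intersection, then the entire family $\mathcal{C}$, except, maybe, one set, has a nonempty intersection. (ii) The Helly number of $\mathcal{C}$ is $\le 4$, and it is exactly $4$ if $C$ is bounded.
   Context: A convex curve is the boundary $C=\partial B$ of a proper convex subset $B$ of the Euclidean plane $\mathbb{R}^2$. A strictly convex curve is a convex curve containing no line segment. A homothet of $C$ is any set of the form $\lambda C+v$ with $\lambda>0$ and $v\in\mathbb{R}^2$. The Helly number of a family $\mathcal{F}$ of sets is the minimal number $\chi$ with the following property: for every subfamily $F\subset\mathcal{F}$, if every subfamily $F_0\subset F$ with $\sharp F_0\le\chi$ has nonempty intersection, then the whole $F$ has nonempty intersection. Here $\sharp$ denotes cardinality.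
   Formalization: "Exactly 4 if C is bounded" is proved for the family of all homothets of C, with C not empty or a single point; for an arbitrary family of homothets it is false (e.g. a family consisting of one circle). *)

theory Defs
  imports "HOL-Analysis.Analysis" "HOL-Library.Extended_Nat"
begin

definition convex_curve :: "(real^2) set \<Rightarrow> bool" where
  "convex_curve C \<longleftrightarrow> (\<exists>B. convex B \<and> B \<noteq> UNIV \<and> C = frontier B)"

(* Degenerate B are allowed: without segments, C may still be a single point or empty. *)
definition strictly_convex_curve :: "(real^2) set \<Rightarrow> bool" where
  "strictly_convex_curve C \<longleftrightarrow>
     convex_curve C \<and> (\<forall>x y. x \<noteq> y \<longrightarrow> \<not> closed_segment x y \<subseteq> C)"

definition homothets :: "(real^2) set \<Rightarrow> (real^2) set set" where
  "homothets C = {(\<lambda>x. l *\<^sub>R x + v) ` C | l v. l > 0}"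

definition helly_property :: "nat \<Rightarrow> 'a set set \<Rightarrow> bool" where
  "helly_property k \<F> \<longleftrightarrow>
     (\<forall>F \<subseteq> \<F>. (\<forall>F\<^sub>0 \<subseteq> F. finite F\<^sub>0 \<and> card F\<^sub>0 \<le> k \<longrightarrow> \<Inter>F\<^sub>0 \<noteq> {}) \<longrightarrow> \<Inter>F \<noteq> {})"

(* Equals \<infinity> if no k has the Helly property; otherwise the infimum is attained.
   The intersection of the empty subfamily is the whole space. *)
definition helly_number :: "'a set set \<Rightarrow> enat" where
  "helly_number \<F> = Inf {enat k | k. helly_property k \<F>}"

end

theory Submission
  imports Defs
begin

text \<open>Every point of a strictly convex curve is an extreme point of the convex hull of the curve.
  Comparing a triangle with a homothetic copy in barycentric coordinates shows that two inscribed
  homothetic triangles coincide, so distinct homothets of the curve share at most two points. This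
  alone gives the positive statements.

  For the lower bound, take four points of the curve and move the last one slightly off the curve.
  The triples inscribed in homothets form a neighbourhood of any inscribed triple, so any three of
  the perturbed points still lie on a common homothet, but all four do not. The four homothets
  through three of these points each then meet three by three, but have no common point.\<close>

section \<open>Convex position\<close>

text \<open>The hull is that of the set itself, so the rigidity argument can be carried out on the
  curve without the convex body behind it.\<close>

definition in_convex_position :: "'a::real_vector set \<Rightarrow> bool" where
  "in_convex_position E \<longleftrightarrow> (\<forall>x\<in>E. x extreme_point_of (convex hull E))"

text \<open>Convex position is always used in this form: writing a point of \<open>E\<close> as a
  convex combination of points of \<open>E\<close> forces it to be one of them. Extremality passes
  to the smaller hull, and extreme points of a hull are generators.\<close>

lemma in_convex_positionD:
  assumes "in_convex_position E" "x \<in> E" "S \<subseteq> E" "x \<in> convex hull S"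
  shows "x \<in> S"
proof -
  have "convex hull S \<subseteq> convex hull E"
    using assms(3) by (rule hull_mono)
  then have "x extreme_point_of (convex hull S)"
    using assms unfolding in_convex_position_def extreme_point_of_def by blast
  then show ?thesis
    by (rule extreme_point_of_convex_hull)
qed

text \<open>A segment between points of \<open>closure B\<close> with a point of \<open>C\<close>
  strictly inside cannot meet the interior of \<open>B\<close>. It then lies wholly in the frontier,
  against strict convexity.\<close>

lemma strictly_convex_curve_in_convex_position:
  assumes "strictly_convex_curve C"
  shows "in_convex_position C"
proof -
  obtain B where B: "convex B" "C = frontier B"
    and nosegment: "\<And>x y. x \<noteq> y \<Longrightarrow> \<not> closed_segment x y \<subseteq> C"
    using assms unfolding strictly_convex_curve_def convex_curve_def by blast
  have extreme: "x \<notin> open_segment a b"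
    if "x \<in> C" "a \<in> closure B" "b \<in> closure B" for x a b
  proof
    assume x: "x \<in> open_segment a b"
    have "m \<notin> interior B" if m: "m \<in> closed_segment a b" for m
    proof
      assume int: "m \<in> interior B"
      \<comment> \<open>Cut the segment at \<open>m\<close>. Points strictly between an interior
        point and a point of the closure are interior.\<close>
      have "x = m \<or> x \<in> open_segment m a \<or> x \<in> open_segment m b"
        using x m Un_closed_segment[OF m]
        by (auto simp: open_segment_def closed_segment_commute)
      then have "x \<in> interior B"
        using in_interior_closure_convex_segment[OF B(1) int] that(1) int
          \<open>a \<in> closure B\<close> \<open>b \<in> closure B\<close> by blast
      then show False
        using \<open>x \<in> C\<close> B(2) by (simp add: frontier_def)
    qed
    moreover have "closed_segment a b \<subseteq> closure B"
      using that B(1) by (simp add: closed_segment_subset)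
    ultimately have "closed_segment a b \<subseteq> C"
      unfolding B(2) frontier_def by blast
    then show False
      using nosegment[of a b] x by (cases "a = b") auto
  qed
  have "convex hull C \<subseteq> closure B"
    unfolding B(2) by (rule hull_minimal) (auto simp: frontier_def B(1))
  then show ?thesis
    unfolding in_convex_position_def extreme_point_of_def
    using extreme by (meson hull_inc subsetD)
qed

lemma in_convex_position_not_collinear:
  fixes a b c :: "'a::euclidean_space"
  assumes "in_convex_position E" "a \<in> E" "b \<in> E" "c \<in> E" "a \<noteq> b" "a \<noteq> c" "b \<noteq> c"
  shows "\<not> collinear {a, b, c}"
proof -
  have "\<not> between (y, z) x" if "x \<in> E" "y \<in> E" "z \<in> E" "x \<noteq> y" "x \<noteq> z" for x y z
    using in_convex_positionD[OF assms(1) \<open>x \<in> E\<close>, of "{y, z}"] that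
    by (auto simp: between_mem_segment segment_convex_hull)
  then show ?thesis
    using assms by (auto simp: collinear_between_cases)
qed

section \<open>Convex combinations and barycentric coordinates\<close>

lemma convex_hull_4I:
  assumes "0 \<le> \<alpha>" "0 \<le> \<beta>" "0 \<le> \<gamma>" "0 \<le> \<delta>" "\<alpha> + \<beta> + \<gamma> + \<delta> = 1"
    and "x = \<alpha> *\<^sub>R p + \<beta> *\<^sub>R q + \<gamma> *\<^sub>R r + \<delta> *\<^sub>R s"
  shows "x \<in> convex hull {p, q, r, s}"
proof -
  \<comment> \<open>Summing over list indices allows the four points to coincide.\<close>
  have "(\<Sum>i<4. ([\<alpha>, \<beta>, \<gamma>, \<delta>] ! i) *\<^sub>R ([p, q, r, s] ! i)) \<in> convex hull {p, q, r, s}"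
    by (rule convex_sum)
      (use assms(1-5) in \<open>auto simp: eval_nat_numeral less_Suc_eq intro!: hull_inc\<close>)
  then show ?thesis
    by (simp add: assms(6) eval_nat_numeral)
qed

lemma barycentric_unique:
  fixes a b c :: "'a::euclidean_space"
  assumes "\<not> collinear {a, b, c}" "\<alpha> + \<beta> + \<gamma> = 0" "\<alpha> *\<^sub>R a + \<beta> *\<^sub>R b + \<gamma> *\<^sub>R c = 0"
  shows "\<alpha> = 0 \<and> \<beta> = 0 \<and> \<gamma> = 0"
proof (rule ccontr)
  have d: "a \<noteq> b" "a \<noteq> c" "b \<noteq> c" "\<not> affine_dependent {a, b, c}"
    using assms(1) by (auto simp: collinear_3_eq_affine_dependent)
  assume "\<not> ?thesis"
  then have "affine_dependent {a, b, c}"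
    using d(1-3) assms(2,3)
    by (auto simp: affine_dependent_explicit_finite add.assoc
        intro!: exI[of _ "\<lambda>x. if x = a then \<alpha> else if x = b then \<beta> else \<gamma>"])
  then show False
    using d(4) by simp
qed


section \<open>Rigidity of inscribed homothetic triangles\<close>

text \<open>A homothety preserves directions, so the step from \<open>e2\<close> to its copy would
  continue the step from \<open>e1\<close> to \<open>e2\<close>. Then \<open>e2\<close> lies
  strictly between \<open>e1\<close> and its own copy, which convex position forbids.\<close>

lemma homothety_no_vertex_chain:
  fixes e1 e2 :: "'a::euclidean_space"
  assumes "in_convex_position E" "e1 \<in> E" "e2 \<in> E" "e1 \<noteq> e2"
    and "0 < s" "s *\<^sub>R e2 + w \<in> E"
  shows "s *\<^sub>R e1 + w \<noteq> e2"
proof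
  assume eq: "s *\<^sub>R e1 + w = e2"
  have "(1 + s) *\<^sub>R e2 = 1 *\<^sub>R (s *\<^sub>R e2 + w) + s *\<^sub>R e1"
    using eq by (simp add: algebra_simps)
  then have "(1 / (1 + s)) *\<^sub>R (1 + s) *\<^sub>R e2
      = (1 / (1 + s)) *\<^sub>R (1 *\<^sub>R (s *\<^sub>R e2 + w) + s *\<^sub>R e1)"
    by (rule arg_cong)
  then have "e2 = (1 / (1 + s)) *\<^sub>R (s *\<^sub>R e2 + w) + (s / (1 + s)) *\<^sub>R e1"
    using assms(5) by (simp add: scaleR_add_right)
  moreover have "1 / (1 + s) + s / (1 + s) = 1"
    using assms(5) by (simp add: add_divide_distrib[symmetric])
  ultimately have "e2 \<in> convex hull {s *\<^sub>R e2 + w, e1}"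
    using assms(5) unfolding convex_hull_2
    by (intro CollectI exI[of _ "1 / (1 + s)"] exI[of _ "s / (1 + s)"]) simp
  then have "e2 \<in> {s *\<^sub>R e2 + w, e1}"
    using assms by - (erule in_convex_positionD[of E, rotated 3], auto)
  then have "s *\<^sub>R e1 = s *\<^sub>R e2"
    using eq assms(4) by (metis add_right_cancel insertE singletonD)
  then show False
    using assms(4,5) by simp
qed

text \<open>In barycentric coordinates with respect to the triangle \<open>e1 e2 e3\<close>, the homothetic copy
  of \<open>e1\<close> lies in the triangle or in the trapezoid spanned by \<open>e2\<close>, \<open>e3\<close> and their copies.\<close>

lemma homothetic_triangle_one_negative:
  fixes e1 e2 e3 :: "'a::euclidean_space"
  assumes pos: "in_convex_position E" and e: "e1 \<in> E" "e2 \<in> E" "e3 \<in> E"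
    and nc: "\<not> collinear {e1, e2, e3}"
    and s: "0 < s" "s \<le> 1" and t: "t1 + t2 + t3 = 1 - s" "t1 < 0" "0 \<le> t2" "0 \<le> t3"
    and w: "w = t1 *\<^sub>R e1 + t2 *\<^sub>R e2 + t3 *\<^sub>R e3"
    and q: "s *\<^sub>R e1 + w \<in> E" "s *\<^sub>R e2 + w \<in> E" "s *\<^sub>R e3 + w \<in> E"
  shows False
proof -
  have d: "e1 \<noteq> e2" "e1 \<noteq> e3" "e2 \<noteq> e3"
    using nc by (auto simp: collinear_3_eq_affine_dependent)
  have q1: "s *\<^sub>R e1 + w = (s + t1) *\<^sub>R e1 + t2 *\<^sub>R e2 + t3 *\<^sub>R e3"
    by (simp add: w algebra_simps)
  have not_e1: "s *\<^sub>R e1 + w \<noteq> e1"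
  proof
    assume "s *\<^sub>R e1 + w = e1"
    then have "(s + t1 - 1) *\<^sub>R e1 + t2 *\<^sub>R e2 + t3 *\<^sub>R e3 = 0"
      unfolding q1 by (simp add: algebra_simps)
    then show False
      using barycentric_unique[OF nc, of "s + t1 - 1" t2 t3] s t by auto
  qed
  have not_e: "s *\<^sub>R e1 + w \<noteq> e2" "s *\<^sub>R e1 + w \<noteq> e3"
    using homothety_no_vertex_chain[OF pos] e d s q by metis+
  show False
  proof (cases "s + t1 \<ge> 0")
    case True
    have "s *\<^sub>R e1 + w \<in> convex hull {e1, e2, e3}"
      unfolding convex_hull_3 q1 using True t
      by (intro CollectI exI[of _ "s + t1"] exI[of _ t2] exI[of _ t3]) simp
    then have "s *\<^sub>R e1 + w \<in> {e1, e2, e3}"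
      using e q by - (erule in_convex_positionD[OF pos _ _, rotated 2], auto)
    then show False
      using not_e not_e1 by auto
  next
    case False
    \<comment> \<open>The first coordinate is \<open>s + t1\<close> for the copy of
      \<open>e1\<close>, \<open>t1\<close> for the copies of \<open>e2\<close> and
      \<open>e3\<close>, and 0 for \<open>e2\<close> and \<open>e3\<close>. So \<sigma> is the total
      weight the two copies must carry; it is split in the ratio \<open>t2 : t3\<close>.\<close>
    define \<sigma> where "\<sigma> = (s + t1) / t1"
    define \<alpha> where "\<alpha> = \<sigma> * (t2 / (t2 + t3))"
    define \<beta> where "\<beta> = \<sigma> * (t3 / (t2 + t3))"
    have t23: "t2 + t3 > 0"
      using s t by linarith
    have \<sigma>: "0 \<le> \<sigma>" "\<sigma> * t1 = s + t1"
      using False t by (auto simp: \<sigma>_def divide_nonpos_nonpos)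
    \<comment> \<open>Multiplied by \<open>t1 < 0\<close>, this is \<open>s\<close> times
      \<open>- (t2 + t3) \<le> s + t1\<close>, which holds because
      \<open>s + t1 + t2 + t3 = 1\<close>. It makes the weights left for \<open>e2\<close> and
      \<open>e3\<close> nonnegative.\<close>
    have \<sigma>': "\<sigma> * s \<le> (1 - \<sigma>) * (t2 + t3)"
    proof -
      have "t1 * ((1 - \<sigma>) * (t2 + t3)) = (t1 - \<sigma> * t1) * (t2 + t3)"
        by (simp add: algebra_simps)
      then have "t1 * ((1 - \<sigma>) * (t2 + t3)) = - s * (t2 + t3)"
        unfolding \<sigma>(2) by simp
      moreover have "t1 * (\<sigma> * s) = s * (s + t1)"
        unfolding \<sigma>(2)[symmetric] by simp
      moreover have "s * (- (t2 + t3)) \<le> s * (s + t1)"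
        using s t by (intro mult_left_mono) auto
      then have "- s * (t2 + t3) \<le> s * (s + t1)"
        by (simp only: mult_minus_left mult_minus_right)
      ultimately have "t1 * ((1 - \<sigma>) * (t2 + t3)) \<le> t1 * (\<sigma> * s)"
        by linarith
      then show ?thesis
        using t(2) by (simp add: mult_le_cancel_left)
    qed
    have sum: "\<alpha> + \<beta> = \<sigma>"
      using t23 by (simp add: \<alpha>_def \<beta>_def distrib_left[symmetric] add_divide_distrib[symmetric])
    have pos\<alpha>: "0 \<le> \<alpha>" "0 \<le> \<beta>"
      using \<sigma> t t23 by (auto simp: \<alpha>_def \<beta>_def)
    have part: "\<sigma> * (r / (t2 + t3)) * s \<le> (1 - \<sigma>) * r" if "0 \<le> r" for r
    proof -
      have "\<sigma> * s * (r / (t2 + t3)) \<le> (1 - \<sigma>) * (t2 + t3) * (r / (t2 + t3))"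
        using \<sigma>' that t23 by (intro mult_right_mono) auto
      also have "\<dots> = (1 - \<sigma>) * r"
        using t23 by simp
      finally show ?thesis
        by (simp add: ac_simps)
    qed
    have g: "0 \<le> (1 - \<sigma>) * t2 - \<alpha> * s" "0 \<le> (1 - \<sigma>) * t3 - \<beta> * s"
      using part t by (auto simp: \<alpha>_def \<beta>_def)
    have 1: "\<alpha> + \<beta> + ((1 - \<sigma>) * t2 - \<alpha> * s) + ((1 - \<sigma>) * t3 - \<beta> * s) = 1"
    proof -
      have "\<alpha> + \<beta> + ((1 - \<sigma>) * t2 - \<alpha> * s) + ((1 - \<sigma>) * t3 - \<beta> * s)
        = (\<alpha> + \<beta>) * (1 - s) + (1 - \<sigma>) * (t1 + t2 + t3) - t1 + \<sigma> * t1"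
        by (simp add: algebra_simps)
      also have "\<dots> = \<sigma> * (1 - s) + (1 - \<sigma>) * (1 - s) + s"
        unfolding sum t(1) \<sigma>(2) by simp
      also have "\<dots> = 1"
        by (simp add: algebra_simps)
      finally show ?thesis .
    qed
    have "s *\<^sub>R e1 + w = \<alpha> *\<^sub>R (s *\<^sub>R e2 + w) + \<beta> *\<^sub>R (s *\<^sub>R e3 + w)
        + ((1 - \<sigma>) * t2 - \<alpha> * s) *\<^sub>R e2 + ((1 - \<sigma>) * t3 - \<beta> * s) *\<^sub>R e3"
    proof -
      have "\<alpha> *\<^sub>R (s *\<^sub>R e2 + w) + \<beta> *\<^sub>R (s *\<^sub>R e3 + w)
        + ((1 - \<sigma>) * t2 - \<alpha> * s) *\<^sub>R e2 + ((1 - \<sigma>) * t3 - \<beta> * s) *\<^sub>R e3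
        = (\<alpha> + \<beta>) *\<^sub>R w + (1 - \<sigma>) *\<^sub>R (t2 *\<^sub>R e2 + t3 *\<^sub>R e3)"
        by (simp add: algebra_simps)
      also have "\<dots> = (\<sigma> * t1) *\<^sub>R e1 + t2 *\<^sub>R e2 + t3 *\<^sub>R e3"
        unfolding sum w by (simp add: algebra_simps)
      finally show ?thesis
        unfolding \<sigma>(2) q1 by simp
    qed
    then have "s *\<^sub>R e1 + w \<in> convex hull {s *\<^sub>R e2 + w, s *\<^sub>R e3 + w, e2, e3}"
      using pos\<alpha> g 1 by (intro convex_hull_4I)
    then have "s *\<^sub>R e1 + w \<in> {s *\<^sub>R e2 + w, s *\<^sub>R e3 + w, e2, e3}"
      using e q by - (erule in_convex_positionD[OF pos _ _, rotated 2], auto)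
    then show False
      using not_e d s by auto
  qed
qed

text \<open>The roles are exchanged: solving the barycentric expression of the copy of
  \<open>e1\<close> for \<open>e1\<close> puts \<open>e1\<close> into the triangle spanned by its
  copy, \<open>e2\<close> and \<open>e3\<close>.\<close>

lemma homothetic_triangle_two_negative:
  fixes e1 e2 e3 :: "'a::euclidean_space"
  assumes pos: "in_convex_position E" and e: "e1 \<in> E" "e2 \<in> E" "e3 \<in> E"
    and nc: "\<not> collinear {e1, e2, e3}"
    and s: "0 < s" "s \<le> 1" and t: "t1 + t2 + t3 = 1 - s" "t2 < 0" "t3 < 0"
    and w: "w = t1 *\<^sub>R e1 + t2 *\<^sub>R e2 + t3 *\<^sub>R e3"
    and q: "s *\<^sub>R e1 + w \<in> E"
  shows False
proof -
  have d: "e1 \<noteq> e2" "e1 \<noteq> e3"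
    using nc by (auto simp: collinear_3_eq_affine_dependent)
  have q1: "s *\<^sub>R e1 + w = (s + t1) *\<^sub>R e1 + t2 *\<^sub>R e2 + t3 *\<^sub>R e3"
    by (simp add: w algebra_simps)
  have not_q1: "s *\<^sub>R e1 + w \<noteq> e1"
  proof
    assume "s *\<^sub>R e1 + w = e1"
    then have "(s + t1 - 1) *\<^sub>R e1 + t2 *\<^sub>R e2 + t3 *\<^sub>R e3 = 0"
      unfolding q1 by (simp add: algebra_simps)
    then show False
      using barycentric_unique[OF nc, of "s + t1 - 1" t2 t3] s t by auto
  qed
  have n: "s + t1 > 0"
    using s t by linarith
  have st: "s + t1 = 1 - t2 - t3"
    using t by simp
  have "(s + t1) *\<^sub>R e1 = (s *\<^sub>R e1 + w) + (- t2) *\<^sub>R e2 + (- t3) *\<^sub>R e3"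
    unfolding q1 by simp
  then have "(1 / (s + t1)) *\<^sub>R (s + t1) *\<^sub>R e1
      = (1 / (s + t1)) *\<^sub>R ((s *\<^sub>R e1 + w) + (- t2) *\<^sub>R e2 + (- t3) *\<^sub>R e3)"
    by (rule arg_cong)
  then have "e1 = (1 / (s + t1)) *\<^sub>R (s *\<^sub>R e1 + w) + (- t2 / (s + t1)) *\<^sub>R e2
      + (- t3 / (s + t1)) *\<^sub>R e3"
    using n by (simp add: scaleR_add_right scaleR_diff_right)
  moreover have "1 / (s + t1) + - t2 / (s + t1) + - t3 / (s + t1) = 1"
    using n st by (simp add: divide_simps)
  ultimately have "e1 \<in> convex hull {s *\<^sub>R e1 + w, e2, e3}"
    unfolding convex_hull_3 using n t
    by (intro CollectI exI[of _ "1 / (s + t1)"] exI[of _ "- t2 / (s + t1)"]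
        exI[of _ "- t3 / (s + t1)"]) (auto intro: divide_nonpos_pos)
  then have "e1 \<in> {s *\<^sub>R e1 + w, e2, e3}"
    using e q by - (erule in_convex_positionD[OF pos _ _, rotated 2], auto)
  then show False
    using d not_q1 by auto
qed

text \<open>The copy of \<open>e1\<close> lies in the original triangle, so it is a vertex. It is
  not \<open>e2\<close> or \<open>e3\<close> by the chain lemma, hence it is \<open>e1\<close>, and
  uniqueness of coordinates applies.\<close>

lemma homothetic_triangle_nonneg:
  fixes e1 e2 e3 :: "'a::euclidean_space"
  assumes pos: "in_convex_position E" and e: "e1 \<in> E" "e2 \<in> E" "e3 \<in> E"
    and nc: "\<not> collinear {e1, e2, e3}"
    and s: "0 < s" and t: "t1 + t2 + t3 = 1 - s" "0 \<le> t1" "0 \<le> t2" "0 \<le> t3"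
    and w: "w = t1 *\<^sub>R e1 + t2 *\<^sub>R e2 + t3 *\<^sub>R e3"
    and q: "s *\<^sub>R e1 + w \<in> E" "s *\<^sub>R e2 + w \<in> E" "s *\<^sub>R e3 + w \<in> E"
  shows "t2 = 0 \<and> t3 = 0"
proof -
  have d: "e1 \<noteq> e2" "e1 \<noteq> e3"
    using nc by (auto simp: collinear_3_eq_affine_dependent)
  have q1: "s *\<^sub>R e1 + w = (s + t1) *\<^sub>R e1 + t2 *\<^sub>R e2 + t3 *\<^sub>R e3"
    by (simp add: w algebra_simps)
  have "s *\<^sub>R e1 + w \<in> convex hull {e1, e2, e3}"
    unfolding convex_hull_3 q1 using s t
    by (intro CollectI exI[of _ "s + t1"] exI[of _ t2] exI[of _ t3]) simp
  then have "s *\<^sub>R e1 + w \<in> {e1, e2, e3}"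
    using e q by - (erule in_convex_positionD[OF pos _ _, rotated 2], auto)
  then have "s *\<^sub>R e1 + w = e1"
    using homothety_no_vertex_chain[OF pos] e d s q by blast
  then have "(s + t1 - 1) *\<^sub>R e1 + t2 *\<^sub>R e2 + t3 *\<^sub>R e3 = 0"
    unfolding q1 by (simp add: algebra_simps)
  then show ?thesis
    using barycentric_unique[OF nc, of "s + t1 - 1" t2 t3] t by auto
qed

lemma homothety_rigid_shrink:
  fixes E :: "(real^2) set"
  assumes pos: "in_convex_position E" and e: "e1 \<in> E" "e2 \<in> E" "e3 \<in> E"
    and d: "e1 \<noteq> e2" "e1 \<noteq> e3" "e2 \<noteq> e3"
    and s: "0 < s" "s \<le> 1"
    and q: "s *\<^sub>R e1 + w \<in> E" "s *\<^sub>R e2 + w \<in> E" "s *\<^sub>R e3 + w \<in> E"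
  shows "s = 1 \<and> w = 0"
proof -
  have nc: "\<not> collinear {e1, e2, e3}"
    by (rule in_convex_position_not_collinear[OF pos e d])
  then have "affine hull {e1, e2, e3} = UNIV"
    using d by (intro affine_independent_span_eq) (auto simp: collinear_3_eq_affine_dependent)
  then obtain a b c where abc: "a + b + c = 1" "s *\<^sub>R e1 + w = a *\<^sub>R e1 + b *\<^sub>R e2 + c *\<^sub>R e3"
    unfolding affine_hull_3 by blast
  \<comment> \<open>These are weights of total \<open>1 - s\<close> for the translation
    \<open>w\<close> rather than for the copy of \<open>e1\<close>; this makes the situation
    symmetric in the three vertices.\<close>
  define t1 t2 t3 where "t1 = a - s" and "t2 = b" and "t3 = c"
  have t: "t1 + t2 + t3 = 1 - s"
    using abc by (simp add: t1_def t2_def t3_def)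
  have w: "w = t1 *\<^sub>R e1 + t2 *\<^sub>R e2 + t3 *\<^sub>R e3"
    using abc(2) by (simp add: t1_def t2_def t3_def algebra_simps)
  have nc': "\<not> collinear {e2, e3, e1}" "\<not> collinear {e3, e1, e2}"
    using nc by (simp_all add: insert_commute)
  have t': "t2 + t3 + t1 = 1 - s" "t3 + t1 + t2 = 1 - s"
    using t by simp_all
  have w': "w = t2 *\<^sub>R e2 + t3 *\<^sub>R e3 + t1 *\<^sub>R e1" "w = t3 *\<^sub>R e3 + t1 *\<^sub>R e1 + t2 *\<^sub>R e2"
    using w by simp_all
  note one = homothetic_triangle_one_negative[OF pos]
    and two = homothetic_triangle_two_negative[OF pos]
  \<comment> \<open>Exactly one negative weight is excluded first, then any two; so no weight is
    negative.\<close>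
  have "\<not> (t1 < 0 \<and> 0 \<le> t2 \<and> 0 \<le> t3)" "\<not> (t2 < 0 \<and> 0 \<le> t3 \<and> 0 \<le> t1)"
    "\<not> (t3 < 0 \<and> 0 \<le> t1 \<and> 0 \<le> t2)"
    using one[OF e nc s t _ _ _ w q] one[OF e(2,3,1) nc'(1) s t'(1) _ _ _ w'(1) q(2,3,1)]
      one[OF e(3,1,2) nc'(2) s t'(2) _ _ _ w'(2) q(3,1,2)] by blast+
  moreover have "\<not> (t2 < 0 \<and> t3 < 0)" "\<not> (t3 < 0 \<and> t1 < 0)" "\<not> (t1 < 0 \<and> t2 < 0)"
    using two[OF e nc s t _ _ w q(1)] two[OF e(2,3,1) nc'(1) s t'(1) _ _ w'(1) q(2)]
      two[OF e(3,1,2) nc'(2) s t'(2) _ _ w'(2) q(3)] by blast+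
  ultimately have nn: "0 \<le> t1" "0 \<le> t2" "0 \<le> t3"
    by linarith+
  have "t2 = 0 \<and> t3 = 0" "t3 = 0 \<and> t1 = 0"
    using homothetic_triangle_nonneg[OF pos e nc s(1) t nn w q]
      homothetic_triangle_nonneg[OF pos e(2,3,1) nc'(1) s(1) t'(1) nn(2,3,1) w'(1) q(2,3,1)]
    by blast+
  then show ?thesis
    using t w by simp
qed

text \<open>Composing one homothety with the inverse of the other carries each \<open>e\<close> to
  its \<open>e'\<close>. The composition taken in the right order has ratio at most 1, which is the
  shrinking case.\<close>

lemma homothety_rigid:
  fixes E :: "(real^2) set"
  assumes pos: "in_convex_position E" and e: "e1 \<in> E" "e2 \<in> E" "e3 \<in> E"
    and d: "e1 \<noteq> e2" "e1 \<noteq> e3" "e2 \<noteq> e3"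
    and m: "0 < l" "0 < l'"
    and e': "e1' \<in> E" "e2' \<in> E" "e3' \<in> E"
    and eq: "l *\<^sub>R e1 + v = l' *\<^sub>R e1' + v'" "l *\<^sub>R e2 + v = l' *\<^sub>R e2' + v'"
      "l *\<^sub>R e3 + v = l' *\<^sub>R e3' + v'"
  shows "l = l' \<and> v = v'"
proof -
  have *: "l = l' \<and> v = v'"
    if le: "l \<le> l'" and pos: "0 < l" "0 < l'" and e: "e1 \<in> E" "e2 \<in> E" "e3 \<in> E"
      and d: "e1 \<noteq> e2" "e1 \<noteq> e3" "e2 \<noteq> e3" and e': "e1' \<in> E" "e2' \<in> E" "e3' \<in> E"
      and eq: "l *\<^sub>R e1 + v = l' *\<^sub>R e1' + v'" "l *\<^sub>R e2 + v = l' *\<^sub>R e2' + v'"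
        "l *\<^sub>R e3 + v = l' *\<^sub>R e3' + v'"
    for l l' :: real and v v' and e1 e2 e3 e1' e2' e3'
  proof -
    have solve: "(l / l') *\<^sub>R x + (1 / l') *\<^sub>R (v - v') = x'"
      if "l *\<^sub>R x + v = l' *\<^sub>R x' + v'" for x x'
    proof -
      have "l' *\<^sub>R x' = l *\<^sub>R x + (v - v')"
        using that by (simp add: algebra_simps)
      then have "(1 / l') *\<^sub>R l' *\<^sub>R x' = (1 / l') *\<^sub>R (l *\<^sub>R x + (v - v'))"
        by (rule arg_cong)
      then show ?thesis
        using pos by (simp add: scaleR_add_right)
    qed
    have "l / l' = 1 \<and> (1 / l') *\<^sub>R (v - v') = 0"
    proof (rule homothety_rigid_shrink[OF \<open>in_convex_position E\<close> e d])
      show "0 < l / l'" "l / l' \<le> 1"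
        using le pos by simp_all
    qed (simp_all only: solve[OF eq(1)] solve[OF eq(2)] solve[OF eq(3)] e')
    then show ?thesis
      using pos by simp
  qed
  \<comment> \<open>Exchanging the two homotheties requires the second triple to be distinct as
    well.\<close>
  have d': "e1' \<noteq> e2'" "e1' \<noteq> e3'" "e2' \<noteq> e3'"
    using d eq m by (metis add_right_cancel order_less_irrefl scaleR_left_imp_eq)+
  show ?thesis
  proof (cases "l \<le> l'")
    case True
    then show ?thesis
      using *[OF True m e d e' eq] by simp
  next
    case False
    then show ?thesis
      using *[OF _ m(2,1) e' d' e eq[symmetric]] by auto
  qed
qed

text \<open>The preimages of the three common points under the two homotheties are homothetic
  inscribed triples, so rigidity applies.\<close>

lemma homothets_eqI:
  assumes "in_convex_position C" "H \<in> homothets C" "H' \<in> homothets C"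
    and "x \<in> H" "y \<in> H" "z \<in> H" "x \<in> H'" "y \<in> H'" "z \<in> H'"
    and "x \<noteq> y" "x \<noteq> z" "y \<noteq> z"
  shows "H = H'"
proof -
  obtain l v where H: "0 < l" "H = (\<lambda>x. l *\<^sub>R x + v) ` C"
    using assms(2) unfolding homothets_def by blast
  obtain l' v' where H': "0 < l'" "H' = (\<lambda>x. l' *\<^sub>R x + v') ` C"
    using assms(3) unfolding homothets_def by blast
  obtain a b c where abc: "a \<in> C" "b \<in> C" "c \<in> C"
    "x = l *\<^sub>R a + v" "y = l *\<^sub>R b + v" "z = l *\<^sub>R c + v"
    using assms(4-6) unfolding H by blast
  obtain a' b' c' where abc': "a' \<in> C" "b' \<in> C" "c' \<in> C"
    "x = l' *\<^sub>R a' + v'" "y = l' *\<^sub>R b' + v'" "z = l' *\<^sub>R c' + v'"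
    using assms(7-9) unfolding H' by blast
  have "l = l' \<and> v = v'"
    using assms(10-12) H(1) H'(1) abc abc'
    by (intro homothety_rigid[OF assms(1) abc(1-3) _ _ _ H(1) H'(1) abc'(1-3)]) auto
  then show ?thesis
    using H H' by simp
qed

section \<open>Families of sets sharing pairwise at most two points\<close>

text \<open>Otherwise every point is missed by two members. Two members \<open>A\<close> and
  \<open>B\<close> then meet in exactly two points \<open>p\<close> and \<open>q\<close>, and two
  members \<open>E1\<close>, \<open>E2\<close> avoiding \<open>q\<close> produce a third common
  point of \<open>A\<close> and \<open>B\<close>.\<close>

lemma triple_intersecting_except_one:
  assumes nonempty: "\<And>A. A \<in> \<F> \<Longrightarrow> A \<noteq> {}"
    and two: "\<And>A B x y z. \<lbrakk>A \<in> \<F>; B \<in> \<F>; A \<noteq> B; x \<in> A \<inter> B; y \<in> A \<inter> B; z \<in> A \<inter> B\<rbrakk>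
      \<Longrightarrow> x = y \<or> x = z \<or> y = z"
    and triple: "\<And>A B D. \<lbrakk>A \<in> \<F>; B \<in> \<F>; D \<in> \<F>; A \<noteq> B; A \<noteq> D; B \<noteq> D\<rbrakk> \<Longrightarrow> A \<inter> B \<inter> D \<noteq> {}"
  shows "\<exists>X. \<Inter>(\<F> - {X}) \<noteq> {}"
proof (rule ccontr)
  assume "\<not> ?thesis"
  \<comment> \<open>Choosing \<open>X\<close> as one member that misses \<open>p\<close> yields a
    second one.\<close>
  then have miss: "\<exists>D\<in>\<F>. D \<noteq> X \<and> p \<notin> D" for X p
    by blast
  obtain A where A: "A \<in> \<F>"
    using miss by blast
  obtain B where B: "B \<in> \<F>" "B \<noteq> A"
    using miss by blast
  obtain b where b: "b \<in> B"
    using nonempty[OF B(1)] by blast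
  \<comment> \<open>\<open>D\<close> differs from \<open>B\<close> because it misses a point of
    \<open>B\<close>.\<close>
  obtain D where D: "D \<in> \<F>" "D \<noteq> A" "b \<notin> D"
    using miss by blast
  obtain p where p: "p \<in> A" "p \<in> B"
    using triple[of A B D] A B D b by blast
  obtain F1 where F1: "F1 \<in> \<F>" "p \<notin> F1"
    using miss by blast
  obtain F2 where F2: "F2 \<in> \<F>" "F2 \<noteq> F1" "p \<notin> F2"
    using miss by blast
  obtain q where q: "q \<in> A" "q \<in> B" "q \<in> F1"
    using triple[of A B F1] A B F1 p by blast
  have pq: "p \<noteq> q"
    using F1 q by blast
  have AB: "x = p \<or> x = q" if "x \<in> A" "x \<in> B" for x
    using two[of A B x p q] A B p q pq that by blast
  have qF2: "q \<in> F2"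
    using triple[of A B F2] A B F2 p AB by blast
  obtain E1 where E1: "E1 \<in> \<F>" "q \<notin> E1"
    using miss by blast
  obtain E2 where E2: "E2 \<in> \<F>" "E2 \<noteq> E1" "q \<notin> E2"
    using miss by blast
  have pE: "p \<in> E1" "p \<in> E2"
    using triple[of A B E1] triple[of A B E2] A B E1 E2 q AB by blast+
  \<comment> \<open>\<open>X\<close> meets \<open>E1\<close> and \<open>F1\<close> in a point other
    than \<open>p\<close> and \<open>q\<close>, and likewise \<open>E2\<close> and
    \<open>F1\<close>. Both points and \<open>q\<close> lie in \<open>X\<close> and
    \<open>F1\<close>, so the two points agree.\<close>
  have common: "\<exists>r. r \<in> X \<and> r \<in> E1 \<and> r \<in> E2 \<and> r \<noteq> p \<and> r \<noteq> q"
    if X: "X \<in> \<F>" "p \<in> X" "q \<in> X" for X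
  proof -
    obtain r where r: "r \<in> X" "r \<in> E1" "r \<in> F1"
      using triple[of X E1 F1] X E1 F1 q pE by blast
    obtain r' where r': "r' \<in> X" "r' \<in> E2" "r' \<in> F1"
      using triple[of X E2 F1] X E2 F1 q pE by blast
    have "r \<noteq> q" "r' \<noteq> q"
      using r r' E1 E2 by blast+
    then have "r' = r"
      using two[of X F1 q r r'] X F1 q r r' by blast
    then show ?thesis
      using r r' F1 \<open>r \<noteq> q\<close> by blast
  qed
  obtain r where r: "r \<in> A" "r \<in> E1" "r \<in> E2" "r \<noteq> p" "r \<noteq> q"
    using common[of A] A p q by blast
  obtain r' where r': "r' \<in> B" "r' \<in> E1" "r' \<in> E2" "r' \<noteq> p" "r' \<noteq> q"
    using common[of B] B p q by blast
  have "r = r'"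
    using two[of E1 E2 p r r'] E1 E2 pE r r' by blast
  then show False
    using AB[of r] r r' by blast
qed

text \<open>Let \<open>p\<close> lie in all members but \<open>X\<close>. For two other members
  \<open>A\<close> and \<open>B\<close>, the set \<open>A \<inter> B\<close> has at most one point
  besides \<open>p\<close>, so every quadruple containing \<open>A\<close>, \<open>B\<close>,
  \<open>X\<close> meets in the same point.\<close>

lemma helly_property_4:
  assumes nonempty: "\<And>A. A \<in> \<F> \<Longrightarrow> A \<noteq> {}"
    and two: "\<And>A B x y z. \<lbrakk>A \<in> \<F>; B \<in> \<F>; A \<noteq> B; x \<in> A \<inter> B; y \<in> A \<inter> B; z \<in> A \<inter> B\<rbrakk>
      \<Longrightarrow> x = y \<or> x = z \<or> y = z"
  shows "helly_property 4 \<F>"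
  unfolding helly_property_def
proof (intro allI impI)
  fix F
  assume F: "F \<subseteq> \<F>"
    and small: "\<forall>F\<^sub>0\<subseteq>F. finite F\<^sub>0 \<and> card F\<^sub>0 \<le> 4 \<longrightarrow> \<Inter>F\<^sub>0 \<noteq> {}"
  have four: "A \<inter> B \<inter> D \<inter> E \<noteq> {}" if "A \<in> F" "B \<in> F" "D \<in> F" "E \<in> F" for A B D E
  proof -
    \<comment> \<open>Repeated members are allowed, so this also covers pairs and triples.\<close>
    have "card (set [A, B, D, E]) \<le> 4"
      by (rule order_trans[OF card_length]) simp
    then have "\<Inter>{A, B, D, E} \<noteq> {}"
      using small[rule_format, of "{A, B, D, E}"] that by simp
    then show ?thesis
      by (simp add: Int_assoc)
  qed
  have "\<exists>X. \<Inter>(F - {X}) \<noteq> {}"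
  proof (rule triple_intersecting_except_one)
    show "A \<inter> B \<inter> D \<noteq> {}" if "A \<in> F" "B \<in> F" "D \<in> F" for A B D
      using four[of A B D D] that by blast
  qed (use F nonempty two in blast)+
  then obtain X p where p: "\<And>A. A \<in> F \<Longrightarrow> A \<noteq> X \<Longrightarrow> p \<in> A"
    by blast
  show "\<Inter>F \<noteq> {}"
  proof (cases "X \<in> F \<and> p \<notin> X")
    case False
    then show ?thesis
      using p by blast
  next
    case X: True
    show ?thesis
    proof (cases "\<exists>A B. A \<in> F \<and> B \<in> F \<and> A \<noteq> X \<and> B \<noteq> X \<and> A \<noteq> B")
      case False
      obtain A where A: "A \<in> F" "\<And>D. D \<in> F \<Longrightarrow> D = A \<or> D = X"
        using False X by metis
      obtain q where "q \<in> A" "q \<in> X"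
        using four[of A A X X] A X by blast
      then have "q \<in> \<Inter>F"
        using A(2) by blast
      then show ?thesis
        by blast
    next
      case True
      then obtain A B where AB: "A \<in> F" "B \<in> F" "A \<noteq> X" "B \<noteq> X" "A \<noteq> B"
        by blast
      obtain q where q: "q \<in> A" "q \<in> B" "q \<in> X"
        using four[of A B X X] AB X by blast
      have "q \<in> E" if E: "E \<in> F" for E
      proof -
        obtain q' where q': "q' \<in> A" "q' \<in> B" "q' \<in> X" "q' \<in> E"
          using four[of A B X E] AB X E by blast
        have "p \<in> A" "p \<in> B" "p \<noteq> q" "p \<noteq> q'"
          using p AB q q' X by auto
        then have "q = q'"
          using two[of A B p q q'] AB F q q' by blast
        then show ?thesis
          using q' by simp
      qed
      then show ?thesis
        by blast
    qed
  qed
qed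

section \<open>Bounds for Helly numbers\<close>

lemma helly_property_mono:
  assumes "helly_property k \<F>" "k \<le> k'"
  shows "helly_property k' \<F>"
  using assms unfolding helly_property_def by (meson order_trans)

lemma helly_number_le:
  assumes "helly_property k \<F>"
  shows "helly_number \<F> \<le> enat k"
  unfolding helly_number_def using assms by (intro Inf_lower) blast

lemma helly_number_ge:
  assumes "\<not> helly_property k \<F>"
  shows "enat (Suc k) \<le> helly_number \<F>"
  unfolding helly_number_def
proof (rule Inf_greatest)
  fix x assume "x \<in> {enat j |j. helly_property j \<F>}"
  then obtain j where j: "x = enat j" "helly_property j \<F>"
    by blast
  then have "\<not> j \<le> k"
    using assms helly_property_mono by blast
  then show "enat (Suc k) \<le> x"
    using j(1) by simp
qed

section \<open>Perturbing inscribed triples\<close>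

text \<open>Outside a large ball the space is connected and free of frontier points, so an unbounded
  \<open>B\<close> contains all of it. Every point is the midpoint of two such far points.\<close>

lemma bounded_convex_if_bounded_frontier:
  fixes B :: "'a::euclidean_space set"
  assumes "convex B" "B \<noteq> UNIV" "bounded (frontier B)" "2 \<le> DIM('a)"
  shows "bounded B"
proof (rule ccontr)
  assume unbounded: "\<not> bounded B"
  obtain R where R: "frontier B \<subseteq> ball 0 R"
    using assms(3) bounded_subset_ballD by blast
  have "connected (- ball (0::'a) R)"
    using assms(4) by (intro connected_complement_bounded_convex) auto
  moreover have "- ball 0 R \<inter> B \<noteq> {}"
    using unbounded bounded_subset[OF bounded_ball, of B 0 R] by blast
  ultimately have outside: "- ball 0 R \<subseteq> B"
    using connected_Int_frontier[of "- ball 0 R" B] R by blast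
  have "x \<in> B" for x
  proof -
    obtain e :: 'a where e: "norm e = 1"
      using vector_choose_size[of 1] by auto
    define y where "y = (norm x + \<bar>R\<bar>) *\<^sub>R e"
    have "norm y = norm x + \<bar>R\<bar>"
      using e by (simp add: y_def)
    then have "R \<le> norm (y + x)" "R \<le> norm (y - x)"
      using norm_diff_ineq[of y x] norm_triangle_ineq2[of y x] by linarith+
    then have "R \<le> norm (x + y)" "R \<le> norm (x - y)"
      by (simp_all add: add.commute norm_minus_commute)
    then have "x + y \<in> B" "x - y \<in> B"
      using outside by (auto simp: subset_iff)
    then have "(1/2) *\<^sub>R (x + y) + (1/2) *\<^sub>R (x - y) \<in> B"
      using assms(1) by (intro convexD) auto
    then show ?thesis
      by (simp add: algebra_simps scaleR_add_left[symmetric])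
  qed
  then show False
    using assms(2) by blast
qed

text \<open>If \<open>B\<close> had empty interior, \<open>C\<close> would be the convex set
  \<open>closure B\<close> and contain a segment. So \<open>B\<close> is a bounded convex set of
  full dimension, like the disc.\<close>

lemma strictly_convex_curve_homeomorphic_sphere:
  assumes "strictly_convex_curve C" "bounded C" "\<not> (\<exists>p. C \<subseteq> {p})"
  shows "C homeomorphic sphere (0::real^2) 1"
proof -
  obtain B where B: "convex B" "B \<noteq> UNIV" "C = frontier B"
    and nosegment: "\<And>x y. x \<noteq> y \<Longrightarrow> \<not> closed_segment x y \<subseteq> C"
    using assms(1) unfolding strictly_convex_curve_def convex_curve_def by blast
  have "interior B \<noteq> {}"
  proof
    assume "interior B = {}"
    then have "C = closure B"
      by (simp add: B(3) frontier_def)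
    then have "convex C"
      using B(1) by simp
    moreover obtain x y where "x \<in> C" "y \<in> C" "x \<noteq> y"
      using assms(3) by blast
    ultimately show False
      using nosegment[of x y] by (simp add: closed_segment_subset)
  qed
  moreover have "bounded B"
    using bounded_convex_if_bounded_frontier[OF B(1,2)] assms(2) B(3) by simp
  moreover have "aff_dim B = aff_dim (cball (0::real^2) 1)"
    using low_dim_interior[of B] \<open>interior B \<noteq> {}\<close> by (auto simp: aff_dim_cball)
  ultimately have "rel_frontier B homeomorphic rel_frontier (cball (0::real^2) 1)"
    using B(1) by (intro homeomorphic_rel_frontiers_convex_bounded_sets) auto
  then show ?thesis
    by (simp add: rel_frontier_nonempty_interior[OF \<open>interior B \<noteq> {}\<close>] B(3))
qed

text \<open>This is the domain of the parametrisation of inscribed triangles. \<open>sgn\<close> is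
  continuous only away from 0, so the nonzero conditions are split off first as
  \<open>V\<close>.\<close>

lemma open_distinct_directions:
  "open {x :: 'a \<times> 'a \<times> 'a::real_normed_vector. fst x \<noteq> 0 \<and> fst (snd x) \<noteq> 0 \<and> snd (snd x) \<noteq> 0
    \<and> sgn (fst x) \<noteq> sgn (fst (snd x)) \<and> sgn (fst x) \<noteq> sgn (snd (snd x))
    \<and> sgn (fst (snd x)) \<noteq> sgn (snd (snd x))}" (is "open ?U")
proof -
  define V :: "('a \<times> 'a \<times> 'a) set"
    where "V = {x. fst x \<noteq> 0} \<inter> {x. fst (snd x) \<noteq> 0} \<inter> {x. snd (snd x) \<noteq> 0}"
  have V: "open V"
    unfolding V_def by (intro open_Int open_Collect_neq continuous_intros)
  have "open (V \<inter> (\<lambda>x. f x - g x) -` (- {0}))"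
    if "continuous_on V f" "continuous_on V g" for f g :: "'a \<times> 'a \<times> 'a \<Rightarrow> 'a"
    using that V by (intro continuous_open_preimage continuous_intros) auto
  note diff = this
  have sgn: "continuous_on V (\<lambda>x. sgn (fst x))" "continuous_on V (\<lambda>x. sgn (fst (snd x)))"
    "continuous_on V (\<lambda>x. sgn (snd (snd x)))"
    by (intro continuous_on_sgn continuous_intros; force simp: V_def)+
  have "?U = (V \<inter> (\<lambda>x. sgn (fst x) - sgn (fst (snd x))) -` (- {0}))
    \<inter> (V \<inter> (\<lambda>x. sgn (fst x) - sgn (snd (snd x))) -` (- {0}))
    \<inter> (V \<inter> (\<lambda>x. sgn (fst (snd x)) - sgn (snd (snd x))) -` (- {0}))"
    by (auto simp: V_def)
  then show ?thesis
    using diff[OF sgn(1,2)] diff[OF sgn(1,3)] diff[OF sgn(2,3)] by (simp add: open_Int)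
qed

text \<open>A parametrisation of inscribed triangles by three directions, a scale and a translation has
  six real parameters. The homothety rigidity makes it injective, so by invariance of domain
  the triples inscribed in some homothet form a neighbourhood of every triple on the curve.\<close>

lemma nearby_triple_on_homothet:
  fixes C :: "(real^2) set"
  assumes pos: "in_convex_position C" and sphere: "C homeomorphic sphere (0::real^2) 1"
    and p: "p1 \<in> C" "p2 \<in> C" "p3 \<in> C" and d: "p1 \<noteq> p2" "p1 \<noteq> p3" "p2 \<noteq> p3"
  shows "\<exists>\<epsilon>>0. \<forall>q. dist q p3 < \<epsilon> \<longrightarrow> (\<exists>H\<in>homothets C. p1 \<in> H \<and> p2 \<in> H \<and> q \<in> H)"
proof -
  obtain k h where hk: "homeomorphism C (sphere (0::real^2) 1) k h"
    using sphere unfolding homeomorphic_def by blast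
  have h: "continuous_on (sphere 0 1) h" "\<And>u. norm u = 1 \<Longrightarrow> h u \<in> C"
    "\<And>u. norm u = 1 \<Longrightarrow> k (h u) = u" "\<And>x. x \<in> C \<Longrightarrow> h (k x) = x" "\<And>x. x \<in> C \<Longrightarrow> norm (k x) = 1"
    using hk unfolding homeomorphism_def by (auto simp: image_iff)
  define U :: "((real^2) \<times> (real^2) \<times> (real^2)) set"
    where "U = {x. fst x \<noteq> 0 \<and> fst (snd x) \<noteq> 0 \<and> snd (snd x) \<noteq> 0
      \<and> sgn (fst x) \<noteq> sgn (fst (snd x)) \<and> sgn (fst x) \<noteq> sgn (snd (snd x))
      \<and> sgn (fst (snd x)) \<noteq> sgn (snd (snd x))}"
  \<comment> \<open>The directions select three points of the curve, the first norm is the scale,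
    and the other two norms give the translation. Subtracting 1 makes unit vectors encode the
    identity homothety.\<close>
  define v :: "(real^2) \<times> (real^2) \<times> (real^2) \<Rightarrow> real^2"
    where "v x = (norm (fst (snd x)) - 1) *\<^sub>R axis 1 1 + (norm (snd (snd x)) - 1) *\<^sub>R axis 2 1" for x
  define f where "f x = (norm (fst x) *\<^sub>R h (sgn (fst x)) + v x,
    norm (fst x) *\<^sub>R h (sgn (fst (snd x))) + v x, norm (fst x) *\<^sub>R h (sgn (snd (snd x))) + v x)" for x
  have "open U"
    unfolding U_def by (rule open_distinct_directions)
  moreover have "continuous_on U f"
  proof -
    have hs: "continuous_on U (\<lambda>x. h (sgn (g x)))"
      if "continuous_on U g" "\<And>x. x \<in> U \<Longrightarrow> g x \<noteq> 0" for g
      using that by (intro continuous_on_compose2[OF h(1)] continuous_on_sgn) (auto simp: norm_sgn)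
    have "continuous_on U (\<lambda>x. h (sgn (fst x)))" "continuous_on U (\<lambda>x. h (sgn (fst (snd x))))"
      "continuous_on U (\<lambda>x. h (sgn (snd (snd x))))"
      by (intro hs continuous_intros; simp add: U_def)+
    then show ?thesis
      unfolding f_def v_def by (intro continuous_intros)
  qed
  moreover have "inj_on f U"
  proof (rule inj_onI)
    fix x y assume x: "x \<in> U" and y: "y \<in> U" and eq: "f x = f y"
    have polar: "norm z *\<^sub>R sgn z = z" for z :: "real^2"
      by (cases "z = 0") (simp_all add: sgn_div_norm)
    have hC: "h (sgn z) \<in> C" "k (h (sgn z)) = sgn z" if "z \<noteq> 0" for z
      using h that by (auto simp: norm_sgn)
    \<comment> \<open>Rigidity recovers scale and translation, hence all three norms; the points of
      the curve then agree, and \<open>k\<close> returns their directions.\<close>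
    have lv: "norm (fst x) = norm (fst y) \<and> v x = v y"
      using x y eq hC
      by (intro homothety_rigid[OF pos, of "h (sgn (fst x))" "h (sgn (fst (snd x)))"
            "h (sgn (snd (snd x)))" _ _ "h (sgn (fst y))" "h (sgn (fst (snd y)))"
            "h (sgn (snd (snd y)))"])
        (auto simp: U_def f_def dest: arg_cong[where f = k])
    then have "v x $ 1 = v y $ 1" "v x $ 2 = v y $ 2"
      by simp_all
    then have norms: "norm (fst x) = norm (fst y)" "norm (fst (snd x)) = norm (fst (snd y))"
      "norm (snd (snd x)) = norm (snd (snd y))"
      using lv by (simp_all add: v_def axis_def)
    have eqI: "z = z'"
      if "norm z = norm z'" "h (sgn z) = h (sgn z')" "z \<noteq> 0" "z' \<noteq> 0" for z z'
    proof -
      have "sgn z = sgn z'"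
        using hC(2)[OF that(3)] hC(2)[OF that(4)] that(2) by argo
      then show ?thesis
        using polar[of z] polar[of z'] that(1) by metis
    qed
    have "fst x = fst y" "fst (snd x) = fst (snd y)" "snd (snd x) = snd (snd y)"
      by (rule eqI; use norms eq lv x y in \<open>simp add: f_def U_def\<close>)+
    then show "x = y"
      by (simp add: prod_eq_iff)
  qed
  ultimately have "open (f ` U)"
    using invariance_of_domain by blast
  moreover have sgn_k: "sgn (k x) = k x" if "x \<in> C" for x
    using h(5)[OF that] by (simp add: sgn_div_norm)
  have "(k p1, k p2, k p3) \<in> U"
  proof -
    have "k a \<noteq> k b" if "a \<in> C" "b \<in> C" "a \<noteq> b" for a b
      using that h(4) by metis
    moreover have "k a \<noteq> 0" if "a \<in> C" for a
      using h(5)[OF that] by auto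
    ultimately show ?thesis
      using p d by (simp add: U_def sgn_k)
  qed
  moreover have "f (k p1, k p2, k p3) = (p1, p2, p3)"
    using p h(4,5) by (simp add: f_def v_def sgn_k)
  ultimately have "open (f ` U)" "(p1, p2, p3) \<in> f ` U"
    by (simp, metis imageI)
  then obtain \<epsilon> where \<epsilon>: "\<epsilon> > 0" "ball (p1, p2, p3) \<epsilon> \<subseteq> f ` U"
    by (meson open_contains_ball)
  have "\<exists>H\<in>homothets C. p1 \<in> H \<and> p2 \<in> H \<and> q \<in> H" if "dist q p3 < \<epsilon>" for q
  proof -
    have "(p1, p2, q) \<in> ball (p1, p2, p3) \<epsilon>"
      using that by (simp add: dist_Pair_Pair dist_commute)
    then have "(p1, p2, q) \<in> f ` U"
      using \<epsilon>(2) by blast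
    then obtain x where x: "x \<in> U" "f x = (p1, p2, q)"
      by (metis imageE)
    define H where "H = (\<lambda>z. norm (fst x) *\<^sub>R z + v x) ` C"
    have "H \<in> homothets C"
      using x(1) unfolding homothets_def H_def U_def
      by (intro CollectI exI[of _ "norm (fst x)"] exI[of _ "v x"]) simp
    moreover have "h (sgn (fst x)) \<in> C" "h (sgn (fst (snd x))) \<in> C" "h (sgn (snd (snd x))) \<in> C"
      using x(1) by (auto simp: U_def norm_sgn intro!: h(2))
    then have "p1 \<in> H" "p2 \<in> H" "q \<in> H"
      using x(2) unfolding f_def H_def by auto
    ultimately show ?thesis
      by blast
  qed
  then show ?thesis
    using \<epsilon>(1) by blast
qed

section \<open>Four homothets meeting only three at a time\<close>

lemma in_convex_position_interior_empty:
  fixes E :: "'a::euclidean_space set"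
  assumes "in_convex_position E"
  shows "interior E = {}"
proof (rule ccontr)
  assume "interior E \<noteq> {}"
  then obtain x \<epsilon> where \<epsilon>: "0 < \<epsilon>" "cball x \<epsilon> \<subseteq> E"
    by (meson ex_in_conv mem_interior_cball)
  \<comment> \<open>The centre of a ball inside \<open>E\<close> is the midpoint of a diameter with
    endpoints in \<open>E\<close>.\<close>
  obtain e :: 'a where e: "norm e = \<epsilon>"
    using vector_choose_size[of \<epsilon>] \<epsilon>(1) by auto
  have "x \<in> E" "{x - e, x + e} \<subseteq> E"
    using \<epsilon> e by (auto simp: subset_iff dist_norm)
  moreover have "x \<in> convex hull {x - e, x + e}"
    unfolding convex_hull_2
    by (intro CollectI exI[of _ "1/2"]) (simp add: scaleR_add_left[symmetric] algebra_simps)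
  ultimately have "x \<in> {x - e, x + e}"
    by (rule in_convex_positionD[OF assms])
  then show False
    using e \<epsilon>(1) by auto
qed

lemma self_in_homothets: "C \<in> homothets C"
  unfolding homothets_def
  by (intro CollectI exI[of _ 1] exI[of _ 0] conjI) simp_all

lemma not_helly_property_3:
  fixes C :: "(real^2) set"
  assumes pos: "in_convex_position C" and sphere: "C homeomorphic sphere (0::real^2) 1"
  shows "\<not> helly_property 3 (homothets C)"
proof -
  have "connected (sphere (0::real^2) 1)"
    by (rule connected_sphere) simp
  moreover have "axis 1 1 \<in> sphere (0::real^2) 1" "- axis 1 1 \<in> sphere (0::real^2) 1"
    "axis 1 1 \<noteq> - axis 1 (1::real) "
    by (auto simp: vec_eq_iff axis_def norm_axis_1[unfolded axis_def])
  ultimately have "infinite (sphere (0::real^2) 1)"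
    by (metis connected_finite_iff_sing empty_iff singletonD)
  then have "infinite C"
    using homeomorphic_finite[of C "sphere (0::real^2) 1"] homeomorphic_finite[of _ C]
      sphere homeomorphic_sym by blast
  then have more: "\<exists>x\<in>C. x \<notin> T" if "finite T" for T
    using that by (meson finite_subset subsetI)
  obtain p1 where p1: "p1 \<in> C"
    using more[of "{}"] by blast
  obtain p2 where p2: "p2 \<in> C" "p1 \<noteq> p2"
    using more[of "{p1}"] by blast
  obtain p3 where p3: "p3 \<in> C" "p1 \<noteq> p3" "p2 \<noteq> p3"
    using more[of "{p1, p2}"] by blast
  obtain p4 where p4: "p4 \<in> C" "p1 \<noteq> p4" "p2 \<noteq> p4" "p3 \<noteq> p4"
    using more[of "{p1, p2, p3}"] by blast
  note p = p1 p2(1) p3(1) p4(1) and d = p2(2) p3(2) p4(2) p3(3) p4(3,4)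
  note near = nearby_triple_on_homothet[OF pos sphere]
  obtain \<epsilon>1 where \<epsilon>1: "\<epsilon>1 > 0"
    "\<And>q. dist q p4 < \<epsilon>1 \<Longrightarrow> \<exists>H\<in>homothets C. p2 \<in> H \<and> p3 \<in> H \<and> q \<in> H"
    using near[OF p(2,3,4) d(4,5,6)] by blast
  obtain \<epsilon>2 where \<epsilon>2: "\<epsilon>2 > 0"
    "\<And>q. dist q p4 < \<epsilon>2 \<Longrightarrow> \<exists>H\<in>homothets C. p1 \<in> H \<and> p3 \<in> H \<and> q \<in> H"
    using near[OF p(1,3,4) d(2,3,6)] by blast
  obtain \<epsilon>3 where \<epsilon>3: "\<epsilon>3 > 0"
    "\<And>q. dist q p4 < \<epsilon>3 \<Longrightarrow> \<exists>H\<in>homothets C. p1 \<in> H \<and> p2 \<in> H \<and> q \<in> H"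
    using near[OF p(1,2,4) d(1,3,5)] by blast
  have "\<not> ball p4 (min \<epsilon>1 (min \<epsilon>2 \<epsilon>3)) \<subseteq> C"
    using in_convex_position_interior_empty[OF pos] \<epsilon>1 \<epsilon>2 \<epsilon>3 mem_interior[of p4 C] by (metis empty_iff min_less_iff_conj)
  then obtain q where "q \<notin> C" "q \<in> ball p4 (min \<epsilon>1 (min \<epsilon>2 \<epsilon>3))"
    by blast
  then have q: "q \<notin> C" "dist q p4 < \<epsilon>1" "dist q p4 < \<epsilon>2" "dist q p4 < \<epsilon>3"
    by (simp_all add: dist_commute)
  obtain H1 where H1: "H1 \<in> homothets C" "p2 \<in> H1" "p3 \<in> H1" "q \<in> H1"
    using \<epsilon>1 q by blast
  obtain H2 where H2: "H2 \<in> homothets C" "p1 \<in> H2" "p3 \<in> H2" "q \<in> H2"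
    using \<epsilon>2 q by blast
  obtain H3 where H3: "H3 \<in> homothets C" "p1 \<in> H3" "p2 \<in> H3" "q \<in> H3"
    using \<epsilon>3 q by blast
  note eqI = homothets_eqI[OF pos _ self_in_homothets]
  \<comment> \<open>With the omitted point, such a homothet would share three points with
    \<open>C\<close> and equal it, but it contains \<open>q\<close>.\<close>
  have missing: "p1 \<notin> H1" "p2 \<notin> H2" "p3 \<notin> H3"
    using eqI[OF H1(1) _ H1(2,3) p(1-3) d(1,2,4)] eqI[OF H2(1,2) _ H2(3) p(1-3) d(1,2,4)]
      eqI[OF H3(1-3) _ p(1-3) d(1,2,4)] H1(4) H2(4) H3(4) q(1) by blast+
  define F where "F = {C, H1, H2, H3}"
  have qp: "q \<noteq> p1" "q \<noteq> p2" "q \<noteq> p3"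
    using p q by blast+
  \<comment> \<open>Since the four homothets are distinct, a subfamily of at most three omits
    one.\<close>
  have "card F = 4"
    unfolding F_def using missing H1 H2 H3 p q by (subst card_insert_disjoint; auto)+
  have "F \<subseteq> homothets C"
    unfolding F_def using H1 H2 H3 self_in_homothets by blast
  moreover have "\<Inter>F\<^sub>0 \<noteq> {}" if F0: "F\<^sub>0 \<subseteq> F" "finite F\<^sub>0" "card F\<^sub>0 \<le> 3" for F\<^sub>0
  proof -
    have "F\<^sub>0 \<noteq> F"
      using F0(3) \<open>card F = 4\<close> by auto
    then have "C \<notin> F\<^sub>0 \<or> H1 \<notin> F\<^sub>0 \<or> H2 \<notin> F\<^sub>0 \<or> H3 \<notin> F\<^sub>0"
      using F0(1) unfolding F_def by blast
    \<comment> \<open>If \<open>C\<close> is omitted, \<open>q\<close> is common to the rest; if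
      \<open>H1\<close>, \<open>H2\<close> or \<open>H3\<close> is omitted, \<open>p1\<close>,
      \<open>p2\<close> or \<open>p3\<close> is.\<close>
    then have "q \<in> \<Inter>F\<^sub>0 \<or> p1 \<in> \<Inter>F\<^sub>0 \<or> p2 \<in> \<Inter>F\<^sub>0 \<or> p3 \<in> \<Inter>F\<^sub>0"
      using F0(1) H1 H2 H3 p unfolding F_def by blast
    then show ?thesis
      by blast
  qed
  moreover have "\<Inter>F = {}"
  proof (rule ccontr)
    assume "\<Inter>F \<noteq> {}"
    then obtain r where r: "r \<in> C" "r \<in> H1" "r \<in> H2" "r \<in> H3"
      unfolding F_def by blast
    \<comment> \<open>A common point \<open>r\<close> differs from \<open>q\<close>, which is off
      \<open>C\<close>, and from \<open>p3\<close>, which is off \<open>H3\<close>. So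
      \<open>H1\<close> and \<open>H2\<close> share three points.\<close>
    have "H1 = H2"
      using H1 H2 r missing qp q
      by (intro homothets_eqI[OF pos H1(1) H2(1), of p3 q r]) auto
    then show False
      using H2(2) missing(1) by blast
  qed
  ultimately show ?thesis
    unfolding helly_property_def by blast
qed

section \<open>The Helly number of homothets\<close>

text \<open>Exactness excludes the degenerate curves: the homothets of the empty curve have Helly
  number 1, those of a single point 2.\<close>

theorem theorem3:
  fixes C :: "(real^2) set" and \<C> :: "(real^2) set set"
  assumes "strictly_convex_curve C"
    and "\<C> \<subseteq> homothets C"
  shows "((\<forall>T \<subseteq> \<C>. card T = 3 \<longrightarrow> \<Inter>T \<noteq> {}) \<longrightarrow> (\<exists>A. \<Inter>(\<C> - {A}) \<noteq> {})) \<and>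
    helly_number \<C> \<le> 4 \<and>
    (bounded C \<and> \<not> (\<exists>p. C \<subseteq> {p}) \<longrightarrow> helly_number (homothets C) = 4)"
proof -
  have pos: "in_convex_position C"
    using assms(1) by (rule strictly_convex_curve_in_convex_position)
  have two: "x = y \<or> x = z \<or> y = z"
    if "A \<in> homothets C" "B \<in> homothets C" "A \<noteq> B" "x \<in> A \<inter> B" "y \<in> A \<inter> B" "z \<in> A \<inter> B"
    for A B x y z
    using homothets_eqI[OF pos, of A B x y z] that by blast
  have nonempty: "A \<noteq> {}" if "C \<noteq> {}" "A \<in> homothets C" for A
    using that unfolding homothets_def by auto
  have empty: "homothets C = {{}}" if "C = {}"
    using that unfolding homothets_def by (auto intro: exI[of _ 1])
  have helly4: "helly_property 4 \<F>" if "\<F> \<subseteq> homothets C" for \<F>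
  proof (cases "C = {}")
    case True
    \<comment> \<open>A family with at most one member is among its own tested subfamilies.\<close>
    have "finite F \<and> card F \<le> 4" if "F \<subseteq> \<F>" for F
    proof -
      have "F \<subseteq> {{}}"
        using empty[OF True] \<open>\<F> \<subseteq> homothets C\<close> that by simp
      then have "F = {} \<or> F = {{}}"
        by (rule subset_singletonD)
      then show ?thesis
        by auto
    qed
    then show ?thesis
      unfolding helly_property_def by blast
  next
    case False
    then show ?thesis
      using helly_property_4[of \<F>] nonempty two that by (meson subsetD)
  qed
  have "\<exists>A. \<Inter>(\<C> - {A}) \<noteq> {}" if triple: "\<forall>T \<subseteq> \<C>. card T = 3 \<longrightarrow> \<Inter>T \<noteq> {}"
  proof (cases "C = {}")
    case True
    have "\<C> \<subseteq> {{}}"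
      using empty[OF True] assms(2) by simp
    \<comment> \<open>Removing the only possible member leaves the empty family, whose intersection
      is the whole plane.\<close>
    then have "\<C> - {{}} = {}"
      by blast
    then have "\<Inter>(\<C> - {{}}) \<noteq> {}"
      by (simp only: Inter_empty UNIV_not_empty not_False_eq_True)
    then show ?thesis
      by blast
  next
    case False
    show ?thesis
    proof (rule triple_intersecting_except_one)
      show "A \<inter> B \<inter> D \<noteq> {}"
        if "A \<in> \<C>" "B \<in> \<C>" "D \<in> \<C>" "A \<noteq> B" "A \<noteq> D" "B \<noteq> D" for A B D
        using triple[rule_format, of "{A, B, D}"] that by (simp add: Int_assoc)
    qed (use False nonempty two assms(2) in blast)+
  qed
  moreover have "helly_number \<C> \<le> 4"
    using helly_number_le[OF helly4[OF assms(2)]] by (simp add: numeral_eq_enat)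
  moreover have "helly_number (homothets C) = 4" if "bounded C" "\<not> (\<exists>p. C \<subseteq> {p})"
  proof (rule antisym)
    have "\<not> helly_property 3 (homothets C)"
      using not_helly_property_3[OF pos] strictly_convex_curve_homeomorphic_sphere[OF assms(1) that]
      by blast
    from helly_number_ge[OF this] show "4 \<le> helly_number (homothets C)"
      by (simp add: numeral_eq_enat)
    show "helly_number (homothets C) \<le> 4"
      using helly_number_le[OF helly4[OF order_refl]] by (simp add: numeral_eq_enat)
  qed
  ultimately show ?thesis
    by blast
qed

end
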